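(* Suppose that Assumption A (see context) holds. Let $\gamma_k>0$ and $\eta_k,\mu_k,\nu_k\ge 0$ for all $k\ge 0$, let $\{\bm{x}^{k}\}$ and $\{\widetilde{\bm{x}}^{k}\}$ be sequences generated by the inexact Bregman proximal point algorithm (iBPPA, see context) with these parameters, and let $f^*:=\min\{f(\bm{x}):\bm{x}\in\overline{\mathcal{C}}\}$. Then the following hold. (i) If $\sup_k\gamma_k<\infty$, $\sum_k\mu_k<\infty$, $\sum_k\nu_k<\infty$ and $\sum_k\eta_k<\infty$, then $f(\widetilde{\bm{x}}^k)\to f^*$. (ii) If $\sup_k\gamma_k<\infty$, $\sum_k\mu_k<\infty$, $\sum_k\gamma_k^{-1}\nu_k<\infty$ and $\sum_k\gamma_k^{-1}\eta_k<\infty$, then the sequences $\{\bm{x}^{k}\}$ and $\{\widetilde{\bm{x}}^{k}\}$ converge to the same limit, which is an optimal solution of $\min\{f(\bm{x}):\bm{x}\in\overline{\mathcal{C}}\}$.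
   Context: $\mathbb{E}$ is a real finite-dimensional Euclidean space with inner product $\langle\cdot,\cdot\rangle$ and induced norm $\|\cdot\|$; $f:\mathbb{E}\to(-\infty,\infty]$ is a proper closed convex function; $\mathcal{C}\subseteq\mathbb{E}$ is a nonempty convex open set with closure $\overline{\mathcal{C}}$. The problem is $\min\{f(\bm{x}):\bm{x}\in\overline{\mathcal{C}}\}$. For $\nu\ge0$ and $\bm{x}\in\mathrm{dom}\,f$, the $\nu$-subdifferential is $\partial_\nu f(\bm{x}):=\{\bm{d}: f(\bm{y})\ge f(\bm{x})+\langle \bm{d},\bm{y}-\bm{x}\rangle-\nu\ \ \forall \bm{y}\in\mathbb{E}\}$. A proper closed convex function $\phi$ is essentially smooth if $\mathrm{int}\,\mathrm{dom}\,\phi\neq\emptyset$, $\phi$ is differentiable on $\mathrm{int}\,\mathrm{dom}\,\phi$, and $\|\nabla\phi(\bm{x}_k)\|\to\infty$ for every sequence in $\mathrm{int}\,\mathrm{dom}\,\phi$ converging to a boundary point of $\mathrm{int}\,\mathrm{dom}\,\phi$. The Bregman distance is $\mathcal{D}_\phi(\bm{x},\bm{y}):=\phi(\bm{x})-\phi(\bm{y})-\langle\nabla\phi(\bm{y}),\bm{x}-\bm{y}\rangle$ (for $\phi$ finite at $\bm{x},\bm{y}$ and differentiable at $\bm{y}$). Bregman function with zone $\mathcal{S}$ ($\mathcal{S}$ nonempty open convex): $\phi:\overline{\mathcal{S}}\to\mathbb{R}$ such that (B1) $\phi$ is strictly convex and continuous on $\overline{\mathcal{S}}$; (B2) $\phi$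 is continuously differentiable on $\mathcal{S}$; (B3) $\{\bm{x}\in\overline{\mathcal{S}}:\mathcal{D}_\phi(\bm{x},\bm{y})\le\alpha\}$ is bounded for every $\bm{y}\in\mathcal{S},\alpha\in\mathbb{R}$, and $\{\bm{y}\in\mathcal{S}:\mathcal{D}_\phi(\bm{x},\bm{y})\le\alpha\}$ is bounded for every $\bm{x}\in\overline{\mathcal{S}},\alpha\in\mathbb{R}$; (B4) if $\{\bm{y}^k\}\subseteq\mathcal{S}$ converges to $\bm{y}^*\in\overline{\mathcal{S}}$, then $\mathcal{D}_\phi(\bm{y}^*,\bm{y}^k)\to0$; (B5) if $\{\bm{x}^k\}\subseteq\overline{\mathcal{S}}$ is bounded, $\{\bm{y}^k\}\subseteq\mathcal{S}$, $\bm{y}^k\to\bm{y}^*$ and $\mathcal{D}_\phi(\bm{x}^k,\bm{y}^k)\to0$, then $\bm{x}^k\to\bm{y}^*$. Assumption A: (i) $\mathrm{dom}\,f\cap\mathcal{C}\ne\emptyset$; (ii) $\rho:=\sup\{\|\bm{x}-\bm{y}\|:\bm{x},\bm{y}\in\mathrm{dom}\,f\cap\overline{\mathcal{C}}\}<\infty$; (iii) $\phi:\mathbb{E}\to(-\infty,\infty]$ is proper closed convex with $\mathrm{dom}\,\phi=\overline{\mathcal{C}}$, $\phi$ is a Bregman function with zone $\mathcal{C}$, and $\phi$ is essentially smooth. iBPPA: choose $\bm{x}^0=\widetilde{\bm{x}}^0\in\mathcal{C}$ arbitrarily. For $k=0,1,2,\dots$, find a pair $(\bm{x}^{k+1},\widetilde{\bm{x}}^{k+1})$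 (by approximately solving $\min_{\bm{x}} f(\bm{x})+\gamma_k\mathcal{D}_\phi(\bm{x},\bm{x}^k)$) such that $\bm{x}^{k+1}\in\mathcal{C}$, $\widetilde{\bm{x}}^{k+1}\in\mathrm{dom}\,f\cap\overline{\mathcal{C}}$ and, for some $\Delta^k\in\mathbb{E}$, $$\Delta^k\in\partial_{\nu_k}f(\widetilde{\bm{x}}^{k+1})+\gamma_k\big(\nabla\phi(\bm{x}^{k+1})-\nabla\phi(\bm{x}^k)\big),\quad \|\Delta^k\|\le\eta_k,\quad \mathcal{D}_\phi(\widetilde{\bm{x}}^{k+1},\bm{x}^{k+1})\le\mu_k.$$ *)

theory Defs
  imports "HOL-Analysis.Analysis"
begin

section \<open>Extended-real-valued convex functions\<close>

text \<open>Functions \<open>\<E> \<rightarrow> (-\<infinity>, \<infinity>]\<close> have type \<open>'a \<Rightarrow> ereal\<close>; the value \<open>-\<infinity>\<close> is excluded by properness.\<close>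

definition edom :: "('a \<Rightarrow> ereal) \<Rightarrow> 'a set" where
  "edom f = {x. f x < \<infinity>}"

definition proper_fun :: "('a \<Rightarrow> ereal) \<Rightarrow> bool" where
  "proper_fun f \<longleftrightarrow> (\<forall>x. f x \<noteq> -\<infinity>) \<and> edom f \<noteq> {}"

definition eepigraph :: "('a \<Rightarrow> ereal) \<Rightarrow> ('a \<times> real) set" where
  "eepigraph f = {(x, r). f x \<le> ereal r}"

definition proper_closed_convex :: "('a::euclidean_space \<Rightarrow> ereal) \<Rightarrow> bool" where
  "proper_closed_convex f \<longleftrightarrow>
     proper_fun f \<and> closed (eepigraph f) \<and> convex (eepigraph f)"

text \<open>Meant for \<open>x \<in> edom f\<close> and \<open>\<nu> \<ge> 0\<close> only.\<close>

definition eps_subdifferential ::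
    "real \<Rightarrow> ('a::euclidean_space \<Rightarrow> ereal) \<Rightarrow> 'a \<Rightarrow> 'a set" where
  "eps_subdifferential \<nu> f x =
     {d. \<forall>y. f y \<ge> f x + ereal (d \<bullet> (y - x)) - ereal \<nu>}"

section \<open>Gradients, Bregman distances and Bregman functions\<close>

definition gradient :: "('a::euclidean_space \<Rightarrow> real) \<Rightarrow> 'a \<Rightarrow> 'a" where
  "gradient h x = (THE D. GDERIV h x :> D)"

lemma GDERIV_unique:
  fixes h :: "'a::euclidean_space \<Rightarrow> real"
  assumes "GDERIV h x :> D" "GDERIV h x :> D'"
  shows "D = D'"
proof -
  have "(\<lambda>v. v \<bullet> D) = (\<lambda>v. v \<bullet> D')"
    using assms unfolding gderiv_def by (rule has_derivative_unique)
  then show ?thesis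
    unfolding fun_eq_iff vector_eq_ldot .
qed

lemma gradient_eqI: "GDERIV h x :> D \<Longrightarrow> gradient h x = D"
  unfolding gradient_def by (rule the_equality) (auto intro: GDERIV_unique)

lemma GDERIV_gradient:
  fixes h :: "'a::euclidean_space \<Rightarrow> real"
  assumes "h differentiable (at x)"
  shows "GDERIV h x :> gradient h x"
proof -
  obtain h' where h': "(h has_derivative h') (at x)"
    using assms unfolding differentiable_def by blast
  define D where "D = adjoint h' 1"
  have "h' v = v \<bullet> D" for v
    using adjoint_works[OF has_derivative_linear[OF h'], of v 1]
    by (simp add: D_def inner_commute)
  then have "h' = (\<lambda>v. v \<bullet> D)"
    by (rule ext)
  with h' have "GDERIV h x :> D"
    unfolding gderiv_def by simp
  then show ?thesis
    by (simp add: gradient_eqI)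
qed

definition bregman_dist :: "('a::euclidean_space \<Rightarrow> real) \<Rightarrow> 'a \<Rightarrow> 'a \<Rightarrow> real" where
  "bregman_dist h x y = h x - h y - gradient h y \<bullet> (x - y)"

definition strictly_convex_on :: "'a::real_vector set \<Rightarrow> ('a \<Rightarrow> real) \<Rightarrow> bool" where
  "strictly_convex_on S h \<longleftrightarrow> convex S \<and>
     (\<forall>x\<in>S. \<forall>y\<in>S. \<forall>t. x \<noteq> y \<longrightarrow> 0 < t \<longrightarrow> t < 1 \<longrightarrow>
        h ((1 - t) *\<^sub>R x + t *\<^sub>R y) < (1 - t) * h x + t * h y)"

text \<open>Only the values of \<open>h\<close> on \<open>closure S\<close> matter: gradients are taken at points of the
  open set \<open>S\<close>.\<close>

definition bregman_function :: "'a::euclidean_space set \<Rightarrow> ('a \<Rightarrow> real) \<Rightarrow> bool" where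
  "bregman_function S h \<longleftrightarrow>
     S \<noteq> {} \<and> open S \<and> convex S \<and>
     (strictly_convex_on (closure S) h \<and> continuous_on (closure S) h) \<and>
     ((\<forall>x\<in>S. h differentiable (at x)) \<and> continuous_on S (gradient h)) \<and>
     ((\<forall>y\<in>S. \<forall>\<alpha>. bounded {x \<in> closure S. bregman_dist h x y \<le> \<alpha>}) \<and>
      (\<forall>x\<in>closure S. \<forall>\<alpha>. bounded {y \<in> S. bregman_dist h x y \<le> \<alpha>})) \<and>
     (\<forall>(y :: nat \<Rightarrow> 'a) l. (\<forall>k. y k \<in> S) \<longrightarrow> l \<in> closure S \<longrightarrow> y \<longlonglongrightarrow> l \<longrightarrow>
        (\<lambda>k. bregman_dist h l (y k)) \<longlonglongrightarrow> 0) \<and>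
     (\<forall>(x :: nat \<Rightarrow> 'a) (y :: nat \<Rightarrow> 'a) l.
        (\<forall>k. x k \<in> closure S) \<longrightarrow> bounded (range x) \<longrightarrow> (\<forall>k. y k \<in> S) \<longrightarrow> y \<longlonglongrightarrow> l \<longrightarrow>
        (\<lambda>k. bregman_dist h (x k) (y k)) \<longlonglongrightarrow> 0 \<longrightarrow> x \<longlonglongrightarrow> l)"

text \<open>The finite part of an extended-real-valued function. It is \<open>0\<close> off the domain, so it is used
  only for values on the domain and for derivatives at interior points of the domain.\<close>

abbreviation fin :: "('a \<Rightarrow> ereal) \<Rightarrow> 'a \<Rightarrow> real" where
  "fin \<phi> \<equiv> (\<lambda>x. real_of_ereal (\<phi> x))"

definition essentially_smooth :: "('a::euclidean_space \<Rightarrow> ereal) \<Rightarrow> bool" where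
  "essentially_smooth \<phi> \<longleftrightarrow>
     proper_closed_convex \<phi> \<and>
     interior (edom \<phi>) \<noteq> {} \<and>
     (\<forall>x\<in>interior (edom \<phi>). fin \<phi> differentiable (at x)) \<and>
     (\<forall>(x :: nat \<Rightarrow> 'a) l.
        (\<forall>k. x k \<in> interior (edom \<phi>)) \<longrightarrow> l \<in> frontier (interior (edom \<phi>)) \<longrightarrow> x \<longlonglongrightarrow> l \<longrightarrow>
        filterlim (\<lambda>k. norm (gradient (fin \<phi>) (x k))) at_top sequentially)"

section \<open>The inexact Bregman proximal point algorithm\<close>

definition assumption_A ::
    "('a::euclidean_space \<Rightarrow> ereal) \<Rightarrow> 'a set \<Rightarrow> ('a \<Rightarrow> ereal) \<Rightarrow> bool" where
  "assumption_A f C \<phi> \<longleftrightarrow>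
     edom f \<inter> C \<noteq> {} \<and>
     Sup {ereal (norm (x - y)) | x y. x \<in> edom f \<inter> closure C \<and> y \<in> edom f \<inter> closure C} < \<infinity> \<and>
     proper_closed_convex \<phi> \<and> edom \<phi> = closure C \<and>
     bregman_function C (fin \<phi>) \<and> essentially_smooth \<phi>"

text \<open>\<open>xt\<close> stands for the sequence written with a tilde. The approximate solution of the
  subproblem is characterised entirely by the inexactness criterion.\<close>

definition iBPPA ::
    "('a::euclidean_space \<Rightarrow> ereal) \<Rightarrow> 'a set \<Rightarrow> ('a \<Rightarrow> ereal) \<Rightarrow>
     (nat \<Rightarrow> real) \<Rightarrow> (nat \<Rightarrow> real) \<Rightarrow> (nat \<Rightarrow> real) \<Rightarrow> (nat \<Rightarrow> real) \<Rightarrow>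
     (nat \<Rightarrow> 'a) \<Rightarrow> (nat \<Rightarrow> 'a) \<Rightarrow> bool" where
  "iBPPA f C \<phi> \<gamma> \<eta> \<mu> \<nu> x xt \<longleftrightarrow>
     x 0 = xt 0 \<and> x 0 \<in> C \<and>
     (\<forall>k. x (Suc k) \<in> C \<and> xt (Suc k) \<in> edom f \<inter> closure C \<and>
        (\<exists>\<Delta>. \<Delta> \<in> {d + \<gamma> k *\<^sub>R (gradient (fin \<phi>) (x (Suc k)) - gradient (fin \<phi>) (x k)) | d.
                    d \<in> eps_subdifferential (\<nu> k) f (xt (Suc k))} \<and>
             norm \<Delta> \<le> \<eta> k \<and>
             bregman_dist (fin \<phi>) (xt (Suc k)) (x (Suc k)) \<le> \<mu> k))"

end

theory Submission
  imports Defs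
begin

text \<open>Write \<open>D\<close> for the Bregman distance of \<open>\<phi>\<close>. Everything rests on one inequality. Testing the
  inexact optimality condition of step \<open>k\<close> against a feasible point \<open>y\<close> and rewriting the gradient
  difference by the four-point identity gives, with \<open>\<rho>\<close> the diameter of the feasible set (the points of \<open>closure C\<close> where \<open>f\<close> is finite),
  \<open>f (xt (k+1)) - f y \<le> \<eta> k * \<rho> + \<nu> k + \<gamma> k * (D y (x k) - D y (x (k+1)) + \<mu> k)\<close>
  (lemma \<open>one_step\<close>). The term \<open>D (xt (k+1)) (x (k+1))\<close> of the identity is controlled by \<open>\<mu> k\<close>, and
  \<open>D (xt (k+1)) (x k)\<close> is dropped because Bregman distances are nonnegative.

  Suppose first that the unscaled errors are summable. With \<open>y = xt k\<close> the inequality says that the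
  values \<open>f (xt k)\<close> decrease up to a summable error, so they converge. If the limit exceeded
  the minimum, then with \<open>y\<close> a minimiser the distance \<open>D y (x k)\<close> would drop by a
  fixed amount at every late step, since \<open>\<gamma>\<close> is bounded; but it cannot become negative.

  Suppose next that the errors divided by \<open>\<gamma> k\<close> are summable. Dividing the inequality by \<open>\<gamma> k\<close> shows that
  \<open>D y (x k)\<close> decreases up to a summable error, hence converges, for every minimiser \<open>y\<close>. This bounds the
  iterates and makes the values converge to the minimum. A cluster point \<open>z\<close> of \<open>x\<close> is
  therefore a minimiser by lower semicontinuity. Along the subsequence approaching \<open>z\<close> the distance
  \<open>D z (x k)\<close> tends to \<open>0\<close>, and because the whole sequence of distances converges, it tends to \<open>0\<close>
  throughout. So \<open>z\<close> is the only cluster point, and \<open>x\<close> converges to it. The points \<open>xt k\<close> follow,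
  as their Bregman distance to \<open>x k\<close> vanishes.

  A minimiser exists because the feasible set is bounded and \<open>f\<close> is lower semicontinuous.\<close>

section \<open>Lower semicontinuity and existence of minimisers\<close>

text \<open>Sequential lower semicontinuity, in the form that a closed epigraph gives directly.\<close>

lemma closed_epigraph_limit_le:
  fixes f :: "'a::euclidean_space \<Rightarrow> ereal"
  assumes "closed (eepigraph f)" "u \<longlonglongrightarrow> l" "r \<longlonglongrightarrow> s" "\<And>n. f (u n) \<le> ereal (r n)"
  shows "f l \<le> ereal s"
proof -
  have "(u n, r n) \<in> eepigraph f" for n
    using assms(4) by (simp add: eepigraph_def)
  then have "(l, s) \<in> eepigraph f"
    by (rule closed_sequentially[OF assms(1) _ tendsto_Pair[OF assms(2,3)]])
  then show ?thesis
    by (simp add: eepigraph_def)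
qed

text \<open>The sublevel sets above the infimum form a chain of nonempty compact sets; any point of their
  intersection is a minimiser. The infimum itself may a priori be \<open>-\<infinity>\<close>, which this argument tolerates.\<close>

lemma exists_arg_min_if_bounded_domain:
  fixes f :: "'a::euclidean_space \<Rightarrow> ereal"
  assumes epi: "closed (eepigraph f)" and K: "closed K" and bdd: "bounded (edom f \<inter> K)"
    and ne: "K \<noteq> {}"
  shows "\<exists>z. is_arg_min f (\<lambda>z. z \<in> K) z"
proof (cases "edom f \<inter> K = {}")
  case True
  then have "f z = \<infinity>" if "z \<in> K" for z
    using that by (force simp: edom_def)
  then show ?thesis
    using ne by (auto simp: is_arg_min_def)
next
  case False
  define m where "m = (INF z\<in>K. f z)"
  define L where "L s = {z \<in> K. f z \<le> ereal s}" for s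
  have "closed (L s)" for s
    unfolding closed_sequential_limits
  proof (intro allI impI, elim conjE)
    fix u l assume u: "\<forall>n. u n \<in> L s" "u \<longlonglongrightarrow> l"
    have "f l \<le> ereal s"
      by (rule closed_epigraph_limit_le[OF epi u(2) tendsto_const]) (use u in \<open>auto simp: L_def\<close>)
    moreover have "l \<in> K"
      using K u by (auto simp: L_def closed_sequential_limits)
    ultimately show "l \<in> L s"
      by (simp add: L_def)
  qed
  moreover have "bounded (L s)" for s
    by (rule bounded_subset[OF bdd]) (force simp: L_def edom_def)
  ultimately have comp: "compact (L s)" for s
    by (simp add: compact_eq_bounded_closed)
  have nonempty: "L s \<noteq> {}" if "m < ereal s" for s
    using that by (force simp: L_def m_def INF_less_iff intro: less_imp_le)
  have "\<Inter>(L ` {s. m < ereal s}) \<noteq> {}"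
  proof (rule compact_chain)
    show "S \<subseteq> T \<or> T \<subseteq> S"
      if ST: "S \<in> L ` {s. m < ereal s} \<and> T \<in> L ` {s. m < ereal s}" for S T
    proof -
      obtain s t where st: "S = L s" "T = L t" using ST by blast
      have "L s \<subseteq> L t" if "s \<le> t" for s t
        using that by (auto simp: L_def intro: order_trans)
      then show ?thesis
        unfolding st by (meson linear)
    qed
  qed (use comp nonempty in auto)
  then obtain z where z: "\<And>s. m < ereal s \<Longrightarrow> z \<in> L s"
    by auto
  obtain p where p: "p \<in> K" "f p < \<infinity>"
    using False by (auto simp: edom_def)
  have "m \<le> f p"
    unfolding m_def using p by (intro INF_lower)
  with p obtain s where "m < ereal s"
    by (metis ereal_dense2 le_less_trans)
  then have "z \<in> K"
    using z by (auto simp: L_def)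
  have "f z \<le> m"
  proof (rule ccontr)
    assume "\<not> f z \<le> m"
    then obtain s where "m < ereal s" "ereal s < f z"
      using ereal_dense2 by (metis not_le)
    with z[of s] show False
      by (auto simp: L_def)
  qed
  moreover have "m \<le> f y" if "y \<in> K" for y
    unfolding m_def using that by (rule INF_lower)
  ultimately show ?thesis
    using \<open>z \<in> K\<close> by (force simp: is_arg_min_def not_less)
qed

section \<open>Bregman distances\<close>

lemma bregman_four_point_identity:
  "(gradient h u - gradient h v) \<bullet> (y - z) =
     bregman_dist h y v - bregman_dist h y u - bregman_dist h z v + bregman_dist h z u"
  by (simp add: bregman_dist_def inner_diff_left inner_diff_right)

text \<open>A convex function lies above its tangents. On the segment from \<open>y\<close> to \<open>x\<close>, convexity bounds the
  difference quotients at \<open>y\<close> by \<open>h x - h y\<close>, and their limit is the directional derivative.\<close>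

lemma bregman_dist_nonneg:
  assumes conv: "strictly_convex_on S h" and xy: "x \<in> S" "y \<in> S"
    and diff: "h differentiable (at y)"
  shows "bregman_dist h x y \<ge> 0"
proof -
  define q where "q t = h (y + t *\<^sub>R (x - y))" for t
  have "(h has_derivative (\<lambda>v. v \<bullet> gradient h y)) (at y)"
    using GDERIV_gradient[OF diff] by (simp add: gderiv_def)
  then have outer: "(h has_derivative (\<lambda>v. v \<bullet> gradient h y)) (at (y + 0 *\<^sub>R (x - y)))"
    by simp
  have "((\<lambda>t. y + t *\<^sub>R (x - y)) has_derivative (\<lambda>t. t *\<^sub>R (x - y))) (at (0::real))"
    by (auto intro!: derivative_eq_intros)
  from has_derivative_compose[OF this outer]
  have "(q has_derivative (\<lambda>t. (t *\<^sub>R (x - y)) \<bullet> gradient h y)) (at 0)"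
    by (simp add: q_def[abs_def])
  then have "DERIV q 0 :> gradient h y \<bullet> (x - y)"
    unfolding has_field_derivative_def
    by (rule has_derivative_eq_rhs) (simp add: fun_eq_iff inner_commute[of "x - y"])
  then have "((\<lambda>t. (q t - q 0) / t) \<longlongrightarrow> gradient h y \<bullet> (x - y)) (at_right 0)"
    by (auto simp: has_field_derivative_iff intro: tendsto_within_subset)
  moreover have "eventually (\<lambda>t. (q t - q 0) / t \<le> h x - h y) (at_right (0::real))"
    using eventually_at_right_less[of 0] eventually_at_right_real[of 0 1, simplified]
  proof eventually_elim
    case (elim t)
    have "q t \<le> (1 - t) * h y + t * h x"
    proof (cases "x = y")
      case False
      have "q t = h ((1 - t) *\<^sub>R y + t *\<^sub>R x)"
        by (simp add: q_def algebra_simps)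
      also have "\<dots> < (1 - t) * h y + t * h x"
        using conv xy elim False unfolding strictly_convex_on_def by auto
      finally show ?thesis by simp
    qed (simp add: q_def algebra_simps)
    then have "q t - q 0 \<le> (h x - h y) * t"
      by (simp add: q_def algebra_simps)
    then show ?case
      using elim by (simp add: divide_le_eq)
  qed
  ultimately have "gradient h y \<bullet> (x - y) \<le> h x - h y"
    by (intro tendsto_upperbound) auto
  then show ?thesis
    by (simp add: bregman_dist_def)
qed

section \<open>Almost decreasing sequences and cluster points\<close>

text \<open>Subtracting the partial sums of the errors leaves a decreasing sequence that is bounded below.\<close>

lemma quasi_decreasing_convergent:
  fixes a e :: "nat \<Rightarrow> real"
  assumes step: "\<And>k. a (Suc k) \<le> a k + e k" and low: "\<And>k. B \<le> a k" and e: "summable e"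
  shows "convergent a"
proof -
  define b where "b k = a k - sum e {..<k}" for k
  have "convergent (\<lambda>k. sum e {..<k})"
    using e by (simp add: summable_iff_convergent)
  then obtain M where M: "\<And>k. \<bar>sum e {..<k}\<bar> \<le> M"
    using Bseq_def convergent_imp_Bseq by (metis real_norm_def)
  have "b (Suc k) \<le> b k" for k
    using step[of k] by (simp add: b_def)
  then have "decseq b"
    by (rule decseq_SucI)
  moreover have "B - M \<le> b k" for k
    using low[of k] M[of k] by (simp add: b_def)
  ultimately have "convergent b"
    using decseq_convergent convergent_def by metis
  then have "convergent (\<lambda>k. b k + sum e {..<k})"
    using e by (intro convergent_add) (simp_all add: summable_iff_convergent)
  then show ?thesis
    by (simp add: b_def)
qed

text \<open>Otherwise infinitely many terms stay away from \<open>l\<close>, and by compactness some subsequence of these converges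
  to a different point.\<close>

lemma bounded_unique_cluster_point_tendsto:
  fixes u :: "nat \<Rightarrow> 'a::heine_borel"
  assumes bdd: "bounded (range u)"
    and uniq: "\<And>r l'. strict_mono r \<Longrightarrow> (u \<circ> r) \<longlonglongrightarrow> l' \<Longrightarrow> l' = l"
  shows "u \<longlonglongrightarrow> l"
proof (rule ccontr)
  assume "\<not> u \<longlonglongrightarrow> l"
  then obtain e where e: "e > 0" "\<not> (\<forall>\<^sub>F n in sequentially. dist (u n) l < e)"
    by (auto simp: tendsto_iff)
  then have inf: "\<exists>n>m. e \<le> dist (u n) l" for m
    by (metis eventually_at_top_dense not_le)
  then have "infinite {n. e \<le> dist (u n) l}"
    by (simp add: infinite_nat_iff_unbounded)
  then obtain r :: "nat \<Rightarrow> nat" where r: "strict_mono r" "\<And>n. e \<le> dist (u (r n)) l"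
    using infinite_enumerate by blast
  have "bounded (range (u \<circ> r))"
    by (rule bounded_subset[OF bdd]) auto
  then obtain l' s where s: "strict_mono s" "((u \<circ> r) \<circ> s) \<longlonglongrightarrow> l'"
    using bounded_imp_convergent_subsequence by blast
  have "l' = l"
    using uniq[of "r \<circ> s" l'] r s by (simp add: strict_mono_o o_assoc)
  with s(2) have "(\<lambda>n. dist (u (r (s n))) l) \<longlonglongrightarrow> 0"
    by (simp add: o_def tendsto_dist_iff[symmetric])
  then have "e \<le> 0"
    by (rule tendsto_lowerbound) (use r in auto)
  with e show False by simp
qed

section \<open>The basic inequality for a run of the algorithm\<close>

locale iBPPA_run =
  fixes f \<phi> :: "'a::euclidean_space \<Rightarrow> ereal" and C :: "'a set"
    and \<gamma> \<eta> \<mu> \<nu> :: "nat \<Rightarrow> real" and x xt :: "nat \<Rightarrow> 'a"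
  assumes f: "proper_closed_convex f"
    and A: "assumption_A f C \<phi>"
    and params: "\<And>k. \<gamma> k > 0" "\<And>k. \<eta> k \<ge> 0" "\<And>k. \<mu> k \<ge> 0" "\<And>k. \<nu> k \<ge> 0"
    and alg: "iBPPA f C \<phi> \<gamma> \<eta> \<mu> \<nu> x xt"
begin

abbreviation D :: "'a \<Rightarrow> 'a \<Rightarrow> real" where
  "D \<equiv> bregman_dist (fin \<phi>)"

abbreviation feasible :: "'a set" where
  "feasible \<equiv> edom f \<inter> closure C"

abbreviation \<rho> :: real where
  "\<rho> \<equiv> diameter feasible"

lemma bregman: "bregman_function C (fin \<phi>)"
  using A by (simp add: assumption_A_def)

lemma D_limit_tendsto_0:
  assumes "\<And>k. y k \<in> C" "l \<in> closure C" "y \<longlonglongrightarrow> l"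
  shows "(\<lambda>k. D l (y k)) \<longlonglongrightarrow> 0"
proof -
  have "\<forall>(y :: nat \<Rightarrow> 'a) l. (\<forall>k. y k \<in> C) \<longrightarrow> l \<in> closure C \<longrightarrow> y \<longlonglongrightarrow> l \<longrightarrow>
      (\<lambda>k. D l (y k)) \<longlonglongrightarrow> 0"
    using bregman unfolding bregman_function_def by (elim conjE)
  from this[rule_format, OF assms] show ?thesis .
qed

lemma tendsto_if_D_tendsto_0:
  assumes "\<And>k. u k \<in> closure C" "bounded (range u)" "\<And>k. y k \<in> C" "y \<longlonglongrightarrow> l"
    and "(\<lambda>k. D (u k) (y k)) \<longlonglongrightarrow> 0"
  shows "u \<longlonglongrightarrow> l"
proof -
  have "\<forall>(u :: nat \<Rightarrow> 'a) (y :: nat \<Rightarrow> 'a) l.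
      (\<forall>k. u k \<in> closure C) \<longrightarrow> bounded (range u) \<longrightarrow> (\<forall>k. y k \<in> C) \<longrightarrow> y \<longlonglongrightarrow> l \<longrightarrow>
      (\<lambda>k. D (u k) (y k)) \<longlonglongrightarrow> 0 \<longrightarrow> u \<longlonglongrightarrow> l"
    using bregman unfolding bregman_function_def by (elim conjE)
  from this[rule_format, OF assms] show ?thesis .
qed

lemma feasible_nonempty: "feasible \<noteq> {}"
  using A closure_subset[of C] by (auto simp: assumption_A_def)

lemma bounded_feasible: "bounded feasible"
proof -
  define W where "W = {ereal (norm (x - y)) | x y. x \<in> feasible \<and> y \<in> feasible}"
  have fin: "Sup W < \<infinity>"
    using A by (simp add: assumption_A_def W_def)
  then obtain B where B: "Sup W < ereal B"
    using ereal_dense2 by blast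
  have "norm (u - v) \<le> B" if "u \<in> feasible" "v \<in> feasible" for u v
  proof -
    have "ereal (norm (u - v)) \<in> W"
      unfolding W_def using that by blast
    then have "ereal (norm (u - v)) \<le> Sup W"
      by (rule Sup_upper)
    then have "ereal (norm (u - v)) < ereal B"
      using B by (rule le_less_trans)
    then show ?thesis by simp
  qed
  then show ?thesis
    unfolding bounded_two_points dist_norm by blast
qed

lemma feasible_finite: "z \<in> feasible \<Longrightarrow> f z = ereal (fin f z)"
  using f by (auto simp: edom_def proper_closed_convex_def proper_fun_def ereal_real)

lemma x_in_C: "x k \<in> C"
  using alg by (cases k) (auto simp: iBPPA_def)

lemma xt_feasible: "xt (Suc k) \<in> feasible"
  using alg by (auto simp: iBPPA_def)

lemma D_xt_le: "D (xt (Suc k)) (x (Suc k)) \<le> \<mu> k"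
  using alg by (auto simp: iBPPA_def)

lemma D_nonneg: "z \<in> closure C \<Longrightarrow> D z (x k) \<ge> 0"
  using bregman x_in_C[of k] closure_subset[of C]
  by (intro bregman_dist_nonneg[of "closure C"]) (auto simp: bregman_function_def)

text \<open>The subgradient inequality bounds the gap by three terms: the residual \<open>\<Delta>\<close> paired with \<open>y - xt (k+1)\<close>, which
  Cauchy-Schwarz and the diameter control, the subgradient error \<open>\<nu> k\<close>, and \<open>\<gamma> k\<close> times the
  gradient difference paired with the same vector, which becomes a telescoping difference of distances to \<open>y\<close>.\<close>

lemma one_step:
  assumes y: "y \<in> feasible"
  shows "fin f (xt (Suc k)) - fin f y \<le>
    \<eta> k * \<rho> + \<nu> k + \<gamma> k * (D y (x k) - D y (x (Suc k)) + \<mu> k)"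
proof -
  let ?g = "gradient (fin \<phi>)" and ?z = "xt (Suc k)"
  obtain d where d: "d \<in> eps_subdifferential (\<nu> k) f ?z"
    and nd: "norm (d + \<gamma> k *\<^sub>R (?g (x (Suc k)) - ?g (x k))) \<le> \<eta> k"
    using alg unfolding iBPPA_def by blast
  define \<Delta> where "\<Delta> = d + \<gamma> k *\<^sub>R (?g (x (Suc k)) - ?g (x k))"
  have "f ?z + ereal (d \<bullet> (y - ?z)) - ereal (\<nu> k) \<le> f y"
    using d by (simp add: eps_subdifferential_def)
  then have "fin f ?z + d \<bullet> (y - ?z) - \<nu> k \<le> fin f y"
    using feasible_finite[OF y] feasible_finite[OF xt_feasible[of k]]
    by (metis ereal_less_eq(3) ereal_minus(1) plus_ereal.simps(1))
  moreover have "d = \<Delta> - \<gamma> k *\<^sub>R (?g (x (Suc k)) - ?g (x k))"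
    by (simp add: \<Delta>_def)
  ultimately have 1: "fin f ?z - fin f y \<le>
      - (\<Delta> \<bullet> (y - ?z)) + \<nu> k + \<gamma> k * ((?g (x (Suc k)) - ?g (x k)) \<bullet> (y - ?z))"
    by (simp only: inner_diff_left inner_scaleR_left)
  have "\<bar>\<Delta> \<bullet> (y - ?z)\<bar> \<le> norm \<Delta> * norm (y - ?z)"
    by (rule Cauchy_Schwarz_ineq2)
  also have "\<dots> \<le> \<eta> k * \<rho>"
    using nd diameter_bounded_bound[OF bounded_feasible y xt_feasible[of k]] params
    by (intro mult_mono) (auto simp: \<Delta>_def dist_norm)
  finally have 2: "- (\<Delta> \<bullet> (y - ?z)) \<le> \<eta> k * \<rho>"
    by simp
  have "(?g (x (Suc k)) - ?g (x k)) \<bullet> (y - ?z) \<le> D y (x k) - D y (x (Suc k)) + \<mu> k"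
    using D_nonneg[of ?z k] D_xt_le[of k] xt_feasible[of k]
    by (simp add: bregman_four_point_identity)
  then have "\<gamma> k * ((?g (x (Suc k)) - ?g (x k)) \<bullet> (y - ?z)) \<le>
      \<gamma> k * (D y (x k) - D y (x (Suc k)) + \<mu> k)"
    using params(1)[of k] by (intro mult_left_mono) auto
  with 1 2 show ?thesis by linarith
qed

section \<open>Minimisers over the feasible set\<close>

lemma exists_minimiser: "\<exists>z. is_arg_min f (\<lambda>z. z \<in> closure C) z"
proof (rule exists_arg_min_if_bounded_domain[OF _ closed_closure bounded_feasible])
  show "closed (eepigraph f)"
    using f by (simp add: proper_closed_convex_def)
  show "closure C \<noteq> {}"
    using feasible_nonempty by auto
qed

lemma minimiser_feasible:
  assumes "is_arg_min f (\<lambda>z. z \<in> closure C) z"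
  shows "z \<in> feasible"
proof -
  obtain p where "p \<in> feasible" using feasible_nonempty by blast
  with assms have "f z \<le> f p" "f p < \<infinity>" "z \<in> closure C"
    by (auto simp: is_arg_min_def edom_def not_less)
  then show ?thesis by (auto simp: edom_def)
qed

lemma minimiser_le:
  assumes z: "is_arg_min f (\<lambda>z. z \<in> closure C) z" and y: "y \<in> feasible"
  shows "fin f z \<le> fin f y"
proof -
  have "f z \<le> f y"
    using assms by (auto simp: is_arg_min_def not_less)
  then show ?thesis
    using feasible_finite[OF y] feasible_finite[OF minimiser_feasible[OF z]]
    by (metis ereal_less_eq(3))
qed

lemma values_tendsto_INF:
  assumes z: "is_arg_min f (\<lambda>z. z \<in> closure C) z"
    and lim: "(\<lambda>k. fin f (xt (Suc k))) \<longlonglongrightarrow> fin f z"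
  shows "(\<lambda>k. f (xt k)) \<longlonglongrightarrow> (INF z\<in>closure C. f z)"
proof -
  have Inf_eq: "(INF z\<in>closure C. f z) = f z"
    using z by (intro antisym INF_lower INF_greatest) (auto simp: is_arg_min_def not_less)
  have "(\<lambda>k. f (xt (Suc k))) \<longlonglongrightarrow> f z"
    by (subst feasible_finite[OF xt_feasible], subst feasible_finite[OF minimiser_feasible[OF z]])
      (rule tendsto_ereal[OF lim])
  then show ?thesis
    unfolding Inf_eq by (rule LIMSEQ_imp_Suc)
qed

section \<open>Convergence of the values under summable errors\<close>

text \<open>The basic inequality at the previous point \<open>y = xt k\<close>: the distance \<open>D (xt k) (x k)\<close> on the right
  is itself at most an inexactness tolerance, so the values can only increase by a summable amount. The first value
  is left out because \<open>xt 0\<close> need not lie in the domain of \<open>f\<close>.\<close>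

lemma values_convergent:
  assumes bdd: "bdd_above (range \<gamma>)"
    and sum: "summable \<mu>" "summable \<nu>" "summable \<eta>"
  shows "convergent (\<lambda>k. fin f (xt (Suc k)))"
proof -
  obtain z where z: "is_arg_min f (\<lambda>z. z \<in> closure C) z"
    using exists_minimiser by blast
  obtain \<Gamma> where \<Gamma>: "\<And>k. \<gamma> k \<le> \<Gamma>"
    using bdd by (auto simp: bdd_above_def)
  define e where "e k = \<eta> (Suc k) * \<rho> + \<nu> (Suc k) + \<Gamma> * (\<mu> k + \<mu> (Suc k))" for k
  show ?thesis
  proof (rule quasi_decreasing_convergent)
    show "summable e"
      unfolding e_def using sum
      by (intro summable_add summable_mult summable_mult2) (simp_all add: summable_Suc_iff)
    show "fin f z \<le> fin f (xt (Suc k))" for k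
      using minimiser_le[OF z xt_feasible] .
    show "fin f (xt (Suc (Suc k))) \<le> fin f (xt (Suc k)) + e k" for k
    proof -
      let ?y = "xt (Suc k)"
      have "D ?y (x (Suc k)) - D ?y (x (Suc (Suc k))) + \<mu> (Suc k) \<le> \<mu> k + \<mu> (Suc k)"
        using D_nonneg[of ?y "Suc (Suc k)"] D_xt_le[of k] xt_feasible[of k] by auto
      then have "\<gamma> (Suc k) * (D ?y (x (Suc k)) - D ?y (x (Suc (Suc k))) + \<mu> (Suc k)) \<le>
          \<gamma> (Suc k) * (\<mu> k + \<mu> (Suc k))"
        using params(1)[of "Suc k"] by (intro mult_left_mono) auto
      also have "\<dots> \<le> \<Gamma> * (\<mu> k + \<mu> (Suc k))"
        using \<Gamma> params(3) by (intro mult_right_mono) (auto intro: add_nonneg_nonneg)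
      finally show ?thesis
        using one_step[OF xt_feasible[of k], of "Suc k"] by (simp add: e_def)
    qed
  qed
qed

text \<open>When \<open>\<gamma> k\<close> tends to \<open>0\<close>, the errors divided by \<open>\<gamma> k\<close> can have an infinite sum, so the distances to a
  minimiser may fail to be almost decreasing. But a gap that stayed away from zero would outweigh the vanishing
  unscaled errors and force these distances down by a fixed amount at each late step, below zero in the end.\<close>

lemma values_tendsto_minimum:
  assumes z: "is_arg_min f (\<lambda>z. z \<in> closure C) z"
    and bdd: "bdd_above (range \<gamma>)"
    and sum: "summable \<mu>" "summable \<nu>" "summable \<eta>"
  shows "(\<lambda>k. fin f (xt (Suc k))) \<longlonglongrightarrow> fin f z"
proof -
  obtain v where v: "(\<lambda>k. fin f (xt (Suc k))) \<longlonglongrightarrow> v"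
    using values_convergent[OF bdd sum] unfolding convergent_def by blast
  obtain \<Gamma> where \<Gamma>: "\<And>k. \<gamma> k \<le> \<Gamma>"
    using bdd by (auto simp: bdd_above_def)
  have \<Gamma>_pos: "\<Gamma> > 0"
    using \<Gamma>[of 0] params(1)[of 0] by linarith
  have "fin f z \<le> v"
    by (rule LIMSEQ_le_const[OF v]) (intro exI allI impI minimiser_le[OF z xt_feasible])
  moreover have False if "fin f z < v"
  proof -
    have "(\<lambda>k. (fin f (xt (Suc k)) - fin f z) - (\<eta> k * \<rho> + \<nu> k + \<Gamma> * \<mu> k)) \<longlonglongrightarrow>
        (v - fin f z) - (0 * \<rho> + 0 + \<Gamma> * 0)"
      using sum by (intro tendsto_intros v summable_LIMSEQ_zero)
    \<comment> \<open>Half of the assumed limiting gap survives after all error terms are paid for.\<close>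
    moreover define \<epsilon> where "\<epsilon> = (v - fin f z) / 2"
    ultimately have "\<forall>\<^sub>F k in sequentially.
        \<epsilon> < (fin f (xt (Suc k)) - fin f z) - (\<eta> k * \<rho> + \<nu> k + \<Gamma> * \<mu> k)"
      using that by (intro order_tendstoD) auto
    then obtain N where N: "\<And>k. k \<ge> N \<Longrightarrow>
        \<epsilon> < (fin f (xt (Suc k)) - fin f z) - (\<eta> k * \<rho> + \<nu> k + \<Gamma> * \<mu> k)"
      by (auto simp: eventually_sequentially)
    have \<epsilon>: "\<epsilon> > 0"
      using that by (simp add: \<epsilon>_def)
    have drop: "D z (x (Suc k)) \<le> D z (x k) - \<epsilon> / \<Gamma>" if "k \<ge> N" for k
    proof -
      have "\<gamma> k * \<mu> k \<le> \<Gamma> * \<mu> k"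
        using \<Gamma> params(3) by (intro mult_right_mono)
      then have gap: "\<epsilon> < \<gamma> k * (D z (x k) - D z (x (Suc k)))"
        using N[OF that] one_step[OF minimiser_feasible[OF z], of k] by (simp add: algebra_simps)
      with \<epsilon> have "0 < \<gamma> k * (D z (x k) - D z (x (Suc k)))"
        by linarith
      then have "0 < D z (x k) - D z (x (Suc k))"
        using params(1)[of k] zero_less_mult_pos by blast
      \<comment> \<open>Replacing \<open>\<gamma> k\<close> by its bound is legitimate only because the decrease is already known to be positive.\<close>
      then have "\<gamma> k * (D z (x k) - D z (x (Suc k))) \<le> \<Gamma> * (D z (x k) - D z (x (Suc k)))"
        using \<Gamma> by (intro mult_right_mono) auto
      with gap have "\<epsilon> \<le> (D z (x k) - D z (x (Suc k))) * \<Gamma>"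
        by (simp add: mult.commute)
      then have "\<epsilon> / \<Gamma> \<le> D z (x k) - D z (x (Suc k))"
        using \<Gamma>_pos by (simp add: divide_le_eq)
      then show ?thesis by simp
    qed
    have iterated: "D z (x (N + n)) \<le> D z (x N) - real n * (\<epsilon> / \<Gamma>)" for n
    proof (induction n)
      case (Suc n)
      then show ?case
        using drop[of "N + n"] by (simp add: algebra_simps add_divide_distrib)
    qed simp
    obtain n where "D z (x N) < real n * (\<epsilon> / \<Gamma>)"
      using \<epsilon> \<Gamma>_pos reals_Archimedean3[of "\<epsilon> / \<Gamma>"] by auto
    with iterated[of n] D_nonneg[of z "N + n"] minimiser_feasible[OF z] show False
      by auto
  qed
  ultimately show ?thesis
    using v by force
qed

section \<open>Convergence of the iterates under scaled summable errors\<close>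

context
  assumes bdd: "bdd_above (range \<gamma>)" and sum_\<mu>: "summable \<mu>"
    and sum_\<nu>: "summable (\<lambda>k. inverse (\<gamma> k) * \<nu> k)"
    and sum_\<eta>: "summable (\<lambda>k. inverse (\<gamma> k) * \<eta> k)"
begin

definition err :: "nat \<Rightarrow> real" where
  "err k = inverse (\<gamma> k) * \<eta> k * \<rho> + inverse (\<gamma> k) * \<nu> k + \<mu> k"

lemma summable_err: "summable err"
  unfolding err_def
  using sum_\<mu> sum_\<nu> sum_\<eta> by (intro summable_add summable_mult2)

lemma scaled_one_step:
  assumes "y \<in> feasible"
  shows "inverse (\<gamma> k) * (fin f (xt (Suc k)) - fin f y) \<le> D y (x k) - D y (x (Suc k)) + err k"
proof -
  have "inverse (\<gamma> k) * (fin f (xt (Suc k)) - fin f y) \<le>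
    inverse (\<gamma> k) * (\<eta> k * \<rho> + \<nu> k + \<gamma> k * (D y (x k) - D y (x (Suc k)) + \<mu> k))"
    using one_step[OF assms, of k] params(1)[of k] by (intro mult_left_mono) auto
  also have "\<dots> = D y (x k) - D y (x (Suc k)) + err k"
    using params(1)[of k] by (simp add: err_def field_simps)
  finally show ?thesis .
qed

lemma D_minimiser_convergent:
  assumes z: "is_arg_min f (\<lambda>z. z \<in> closure C) z"
  shows "convergent (\<lambda>k. D z (x k))"
proof (rule quasi_decreasing_convergent[OF _ _ summable_err])
  show "0 \<le> D z (x k)" for k
    using D_nonneg minimiser_feasible[OF z] by blast
  show "D z (x (Suc k)) \<le> D z (x k) + err k" for k
  proof -
    have "0 \<le> inverse (\<gamma> k) * (fin f (xt (Suc k)) - fin f z)"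
      using params(1)[of k] minimiser_le[OF z xt_feasible] by (simp add: less_imp_le)
    then show ?thesis
      using scaled_one_step[OF minimiser_feasible[OF z], of k] by linarith
  qed
qed

text \<open>The scaled gap is squeezed between \<open>0\<close> and the increments of a convergent sequence plus vanishing errors;
  boundedness of \<open>\<gamma>\<close> removes the scaling.\<close>

lemma scaled_values_tendsto_minimum:
  assumes z: "is_arg_min f (\<lambda>z. z \<in> closure C) z"
  shows "(\<lambda>k. fin f (xt (Suc k))) \<longlonglongrightarrow> fin f z"
proof -
  obtain \<Gamma> where \<Gamma>: "\<And>k. \<gamma> k \<le> \<Gamma>"
    using bdd by (auto simp: bdd_above_def)
  obtain a where a: "(\<lambda>k. D z (x k)) \<longlonglongrightarrow> a"
    using D_minimiser_convergent[OF z] unfolding convergent_def by blast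
  let ?u = "\<lambda>k. D z (x k) - D z (x (Suc k)) + err k"
  have "?u \<longlonglongrightarrow> a - a + 0"
    by (intro tendsto_intros a LIMSEQ_Suc[OF a] summable_LIMSEQ_zero summable_err)
  then have u: "(\<lambda>k. \<Gamma> * ?u k) \<longlonglongrightarrow> 0"
    using tendsto_mult_left[of ?u 0 sequentially \<Gamma>] by simp
  have gap_nonneg: "0 \<le> fin f (xt (Suc k)) - fin f z" for k
    using minimiser_le[OF z xt_feasible] by simp
  have "(\<lambda>k. fin f (xt (Suc k)) - fin f z) \<longlonglongrightarrow> 0"
  proof (rule tendsto_sandwich[OF _ _ tendsto_const u])
    have "fin f (xt (Suc k)) - fin f z \<le> \<Gamma> * ?u k" for k
    proof -
      have "fin f (xt (Suc k)) - fin f z = \<gamma> k * (inverse (\<gamma> k) * (fin f (xt (Suc k)) - fin f z))"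
        using params(1)[of k] by simp
      also have "\<dots> \<le> \<Gamma> * (inverse (\<gamma> k) * (fin f (xt (Suc k)) - fin f z))"
        using \<Gamma> gap_nonneg[of k] params(1)[of k]
        by (intro mult_right_mono mult_nonneg_nonneg) (auto simp: less_imp_le)
      also have "\<dots> \<le> \<Gamma> * ?u k"
        using scaled_one_step[OF minimiser_feasible[OF z], of k] \<Gamma>[of k] params(1)[of k]
        by (intro mult_left_mono) auto
      finally show ?thesis .
    qed
    then show "\<forall>\<^sub>F k in sequentially. fin f (xt (Suc k)) - fin f z \<le> \<Gamma> * ?u k"
      by simp
  qed (use gap_nonneg in auto)
  then show ?thesis
    by (simp add: LIM_zero_iff)
qed

text \<open>The iterates stay in a level set of \<open>D z\<close> for a minimiser \<open>z\<close>, and such level sets are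
  bounded for a Bregman function.\<close>

lemma bounded_iterates: "bounded (range x)"
proof -
  obtain z where z: "is_arg_min f (\<lambda>z. z \<in> closure C) z"
    using exists_minimiser by blast
  obtain M where M: "\<And>k. \<bar>D z (x k)\<bar> \<le> M"
    using convergent_imp_Bseq[OF D_minimiser_convergent[OF z]] Bseq_def by (metis real_norm_def)
  have "D z (x k) \<le> M" for k
    using M[of k] by linarith
  then have "range x \<subseteq> {y \<in> C. D z y \<le> M}"
    using x_in_C by auto
  moreover have "bounded {y \<in> C. D z y \<le> M}"
    using bregman minimiser_feasible[OF z] by (auto simp: bregman_function_def)
  ultimately show ?thesis
    using bounded_subset by blast
qed

text \<open>The indices are successors because only the points \<open>xt (k+1)\<close> are controlled by the inexactness
  criterion. Convergence passes from \<open>x\<close> to \<open>xt\<close> by the last property of a Bregman function, for which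
  the bounded feasible set supplies the boundedness.\<close>

lemma xt_tendsto_subseq:
  assumes "strict_mono r" "(\<lambda>n. x (Suc (r n))) \<longlonglongrightarrow> l"
  shows "(\<lambda>n. xt (Suc (r n))) \<longlonglongrightarrow> l"
proof -
  have \<mu>: "(\<lambda>n. \<mu> (r n)) \<longlonglongrightarrow> 0"
    using LIMSEQ_subseq_LIMSEQ[OF summable_LIMSEQ_zero[OF sum_\<mu>] assms(1)] by (simp add: o_def)
  have D: "(\<lambda>n. D (xt (Suc (r n))) (x (Suc (r n)))) \<longlonglongrightarrow> 0"
    by (rule tendsto_sandwich[OF _ _ tendsto_const \<mu>])
      (use D_nonneg xt_feasible D_xt_le in auto)
  have bdd_xt: "bounded (range (\<lambda>n. xt (Suc (r n))))"
    by (rule bounded_subset[OF bounded_feasible]) (use xt_feasible in auto)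
  have "xt (Suc (r n)) \<in> closure C" for n
    using xt_feasible by blast
  then show ?thesis
    by (rule tendsto_if_D_tendsto_0[OF _ bdd_xt x_in_C assms(2) D])
qed

lemma cluster_point_minimiser:
  assumes "strict_mono r" "(\<lambda>n. x (Suc (r n))) \<longlonglongrightarrow> l"
  shows "is_arg_min f (\<lambda>z. z \<in> closure C) l"
proof -
  obtain z where z: "is_arg_min f (\<lambda>z. z \<in> closure C) z"
    using exists_minimiser by blast
  have "(\<lambda>n. fin f (xt (Suc (r n)))) \<longlonglongrightarrow> fin f z"
    using LIMSEQ_subseq_LIMSEQ[OF scaled_values_tendsto_minimum[OF z] assms(1)] by (simp add: o_def)
  moreover have "closed (eepigraph f)"
    using f by (simp add: proper_closed_convex_def)
  moreover have "f (xt (Suc (r n))) \<le> ereal (fin f (xt (Suc (r n))))" for n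
    using feasible_finite[OF xt_feasible] by (rule eq_refl)
  ultimately have "f l \<le> ereal (fin f z)"
    using closed_epigraph_limit_le xt_tendsto_subseq[OF assms] by blast
  then have "f l \<le> f z"
    unfolding feasible_finite[OF minimiser_feasible[OF z], symmetric] .
  moreover have "l \<in> closure C"
    by (rule closed_sequentially[OF closed_closure _ assms(2)])
      (use x_in_C closure_subset in blast)
  ultimately show ?thesis
    using z unfolding is_arg_min_def by (meson le_less_trans not_le)
qed

text \<open>This is the pattern of Opial's lemma: the distance to one cluster point converges on the
  whole sequence and vanishes on a subsequence, hence vanishes, which excludes every other cluster point.\<close>

lemma iterates_converge:
  "\<exists>z. x \<longlonglongrightarrow> z \<and> xt \<longlonglongrightarrow> z \<and> is_arg_min f (\<lambda>z. z \<in> closure C) z"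
proof -
  have "bounded (range (\<lambda>k. x (Suc k)))"
    by (rule bounded_subset[OF bounded_iterates]) auto
  then obtain z r where r: "strict_mono r" "(\<lambda>n. x (Suc (r n))) \<longlonglongrightarrow> z"
    using bounded_imp_convergent_subsequence[of "\<lambda>k. x (Suc k)"] by (auto simp: o_def)
  have z: "is_arg_min f (\<lambda>z. z \<in> closure C) z"
    using cluster_point_minimiser[OF r] .
  then have zC: "z \<in> closure C"
    by (simp add: is_arg_min_def)
  obtain a where a: "(\<lambda>k. D z (x k)) \<longlonglongrightarrow> a"
    using D_minimiser_convergent[OF z] unfolding convergent_def by blast
  have "(\<lambda>n. D z (x (Suc (r n)))) \<longlonglongrightarrow> a"
    using LIMSEQ_subseq_LIMSEQ[OF LIMSEQ_Suc[OF a] r(1)] by (simp add: o_def)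
  moreover have "(\<lambda>n. D z (x (Suc (r n)))) \<longlonglongrightarrow> 0"
    by (rule D_limit_tendsto_0[OF x_in_C zC r(2)])
  ultimately have "a = 0"
    by (rule LIMSEQ_unique)
  have x: "x \<longlonglongrightarrow> z"
  proof (rule bounded_unique_cluster_point_tendsto[OF bounded_iterates])
    fix s l assume s: "strict_mono s" "(x \<circ> s) \<longlonglongrightarrow> l"
    \<comment> \<open>The constant sequence \<open>z\<close> is Bregman-close to iterates that approach \<open>l\<close>.\<close>
    have "(\<lambda>n. D z ((x \<circ> s) n)) \<longlonglongrightarrow> 0"
      using LIMSEQ_subseq_LIMSEQ[OF a s(1)] \<open>a = 0\<close> by (simp add: o_def)
    moreover have "(x \<circ> s) n \<in> C" for n
      using x_in_C by simp
    moreover have "bounded (range (\<lambda>n::nat. z))"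
      by simp
    ultimately have "(\<lambda>n::nat. z) \<longlonglongrightarrow> l"
      using tendsto_if_D_tendsto_0[of "\<lambda>_. z" "x \<circ> s" l] zC s(2) by blast
    then show "l = z"
      by (simp add: LIMSEQ_const_iff)
  qed
  have "(\<lambda>n. xt (Suc n)) \<longlonglongrightarrow> z"
    using xt_tendsto_subseq[of "\<lambda>n. n", OF _ LIMSEQ_Suc[OF x]] by (simp add: strict_mono_def)
  then have "xt \<longlonglongrightarrow> z"
    by (rule LIMSEQ_imp_Suc)
  with x z show ?thesis by blast
qed

end

end

section \<open>Convergence of the algorithm\<close>

theorem theorem3p2:
  fixes f \<phi> :: "'a::euclidean_space \<Rightarrow> ereal" and C :: "'a set"
    and \<gamma> \<eta> \<mu> \<nu> :: "nat \<Rightarrow> real" and x xt :: "nat \<Rightarrow> 'a"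
  assumes f: "proper_closed_convex f"
    and C: "C \<noteq> {}" "convex C" "open C"
    and A: "assumption_A f C \<phi>"
    and params: "\<And>k. \<gamma> k > 0" "\<And>k. \<eta> k \<ge> 0" "\<And>k. \<mu> k \<ge> 0" "\<And>k. \<nu> k \<ge> 0"
    and alg: "iBPPA f C \<phi> \<gamma> \<eta> \<mu> \<nu> x xt"
  shows "(\<exists>xs. is_arg_min f (\<lambda>z. z \<in> closure C) xs) \<and>
    (bdd_above (range \<gamma>) \<and> summable \<mu> \<and> summable \<nu> \<and> summable \<eta> \<longrightarrow>
       (\<lambda>k. f (xt k)) \<longlonglongrightarrow> (INF z\<in>closure C. f z)) \<and>
    (bdd_above (range \<gamma>) \<and> summable \<mu> \<and>
       summable (\<lambda>k. inverse (\<gamma> k) * \<nu> k) \<and> summable (\<lambda>k. inverse (\<gamma> k) * \<eta> k) \<longrightarrow>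
       (\<exists>xs. x \<longlonglongrightarrow> xs \<and> xt \<longlonglongrightarrow> xs \<and> is_arg_min f (\<lambda>z. z \<in> closure C) xs))"
proof -
  interpret iBPPA_run f \<phi> C \<gamma> \<eta> \<mu> \<nu> x xt
    using f A params alg by unfold_locales
  obtain z where z: "is_arg_min f (\<lambda>z. z \<in> closure C) z"
    using exists_minimiser by blast
  show ?thesis
  proof (intro conjI impI; (elim conjE)?)
    show "\<exists>xs. is_arg_min f (\<lambda>z. z \<in> closure C) xs"
      using z by blast
  next
    assume "bdd_above (range \<gamma>)" "summable \<mu>" "summable \<nu>" "summable \<eta>"
    then show "(\<lambda>k. f (xt k)) \<longlonglongrightarrow> (INF z\<in>closure C. f z)"
      by (rule values_tendsto_INF[OF z values_tendsto_minimum[OF z]])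
  next
    assume "bdd_above (range \<gamma>)" "summable \<mu>"
      "summable (\<lambda>k. inverse (\<gamma> k) * \<nu> k)" "summable (\<lambda>k. inverse (\<gamma> k) * \<eta> k)"
    then show "\<exists>xs. x \<longlonglongrightarrow> xs \<and> xt \<longlonglongrightarrow> xs \<and> is_arg_min f (\<lambda>z. z \<in> closure C) xs"
      by (rule iterates_converge)
  qed
qed

end
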